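(* Let $K\in\mathcal{C}_0$ and $K\supset rB$, where either (i) $r>1$, or (ii) $r=1$ and $K$ is compact, or (iii) $0<r<1$ and $\|K\|<r/(1-r)$. Then the continued fraction with constant term $K$, $$F_n=[\underbrace{K,\dots,K}_{n}],\qquad n\ge1,$$ converges in the Hausdorff metric to a convex body $F\in\mathcal{K}_0$ that satisfies the equation $F^*=F+K$.
   Context: $\mathcal{C}_0$ is the family of all convex closed sets in $\mathbb{R}^d$ containing the origin, and $\mathcal{K}_0$ is the family of convex bodies (convex compact sets) in $\mathbb{R}^d$ containing the origin. $B$ is the unit Euclidean ball centred at the origin. Inclusions are non-strict. $K+L$ is the closed Minkowski sum, i.e. the closure of $\{x+y: x\in K, y\in L\}$; $aK=\{ax:x\in K\}$ for $a>0$. The polar of $K\in\mathcal{C}_0$ is $K^*=\{u\in\mathbb{R}^d: \langle u,x\rangle\le1\text{ for all }x\in K\}$. $\|K\|=\sup\{\|x\|:x\in K\}$ (possibly $\infty$). The Hausdorff distance is $\rho_H(K,L)=\inf\{\varepsilon>0: K\subset L+\varepsilon B,\ L\subset K+\varepsilon B\}$. Approximants are defined by $[K_1]=K_1^*$ and $[K_1,\dots,K_{n+1}]=(K_1+[K_2,\dots,K_{n+1}])^*$, $n\ge1$. *)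

theory Defs
  imports "HOL-Analysis.Analysis"
begin

definition closed_convex_sets0 :: "'a::euclidean_space set set" where
  "closed_convex_sets0 = {K. convex K \<and> closed K \<and> 0 \<in> K}"

definition convex_bodies0 :: "'a::euclidean_space set set" where
  "convex_bodies0 = {K. convex K \<and> compact K \<and> 0 \<in> K}"

abbreviation unit_ball :: "'a::euclidean_space set" where
  "unit_ball \<equiv> cball 0 1"

definition dilate :: "real \<Rightarrow> 'a::euclidean_space set \<Rightarrow> 'a set" where
  "dilate a K = {a *\<^sub>R x | x. x \<in> K}"

definition closed_msum :: "'a::euclidean_space set \<Rightarrow> 'a set \<Rightarrow> 'a set" (infixl "\<oplus>\<^sub>M" 65) where
  "K \<oplus>\<^sub>M L = closure {x + y | x y. x \<in> K \<and> y \<in> L}"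

definition polar :: "'a::euclidean_space set \<Rightarrow> 'a set" where
  "polar K = {u. \<forall>x\<in>K. u \<bullet> x \<le> 1}"

text \<open>Both \<open>set_norm\<close> and \<open>hausdorff_distance\<close> take values in \<^typ>\<open>ereal\<close>, so that
  the supremum over an unbounded set and the infimum over the empty set are \<open>\<infinity>\<close>.\<close>

definition set_norm :: "'a::euclidean_space set \<Rightarrow> ereal" where
  "set_norm K = (SUP x\<in>K. ereal (norm x))"

definition hausdorff_distance :: "'a::euclidean_space set \<Rightarrow> 'a set \<Rightarrow> ereal" where
  "hausdorff_distance K L =
     Inf {ereal \<epsilon> | \<epsilon>. \<epsilon> > 0 \<and> K \<subseteq> L \<oplus>\<^sub>M dilate \<epsilon> unit_ball \<and> L \<subseteq> K \<oplus>\<^sub>M dilate \<epsilon> unit_ball}"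

text \<open>The approximant of the empty list is left unspecified; it does not occur in the
  approximants of nonempty lists.\<close>

fun approximant :: "'a::euclidean_space set list \<Rightarrow> 'a set" where
  "approximant [K] = polar K"
| "approximant (K # L # Ls) = polar (K \<oplus>\<^sub>M approximant (L # Ls))"

end

theory Submission
  imports Defs
begin

text \<open>
  The approximants are the iterates \<open>F\<^sub>n = T\<^sup>n {0}\<close>, \<open>n \<ge> 1\<close>, of the map \<open>T L = (K + L)\<^sup>*\<close>, and
  the limit is a fixed point of \<open>T\<close>: the bipolar theorem turns \<open>F = (K + F)\<^sup>*\<close> into
  \<open>F\<^sup>* = F + K\<close>.

  Convergence combines an order argument with a metric one. Since \<open>T\<close> reverses inclusions, every
  even iterate lies inside every odd one (\<open>even_iterate_subset_odd_iterate\<close>), so the intersection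
  \<open>F\<close> of the odd iterates is squeezed between them. This gives the limit explicitly, without
  completeness of the Hausdorff metric; it remains to see that consecutive iterates come close to
  each other.

  On sets \<open>L\<close> for which \<open>K + L\<close> contains the ball of radius \<open>q\<close>, the map \<open>T\<close> is Lipschitz with
  constant \<open>1 / q\<^sup>2\<close> (\<open>cf_step_contracts\<close>), so it suffices that \<open>K + F\<^sub>n\<close> contains a fixed ball of radius
  \<open>q > 1\<close> for all large \<open>n\<close>. For \<open>r > 1\<close> this is immediate. In the other two cases
  \<open>K\<close> lies in a ball of radius \<open>R\<close> with \<open>R (1 - r) < r\<close>. Applying \<open>T\<close> twice to a set containing
  \<open>a B\<close> gives a set containing \<open>g(a) B\<close> with \<open>g(a) = 1 / (R + 1 / (r + a))\<close>, and the
  condition on \<open>R\<close> says exactly that \<open>g(a) > a\<close> for all \<open>0 \<le> a \<le> 1 - r\<close>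
  (\<open>inradius_growth\<close>). The inscribed radius therefore exceeds \<open>1 - r\<close> after finitely many
  steps (\<open>inradius_eventually_large\<close>), and then \<open>q = r + a > 1\<close>.
\<close>

section \<open>Polars and the bipolar theorem\<close>

lemma zero_in_polar: "0 \<in> polar K"
  by (simp add: polar_def)

lemma polar_eq_Inter: "polar K = (\<Inter>x\<in>K. {u. x \<bullet> u \<le> 1})"
  by (auto simp: polar_def inner_commute)

lemma convex_polar: "convex (polar K)"
  unfolding polar_eq_Inter by (intro convex_INT convex_halfspace_le)

lemma closed_polar: "closed (polar K)"
  unfolding polar_eq_Inter by (intro closed_INT ballI closed_halfspace_le)

text \<open>A point outside a closed convex set containing the origin is separated from it by a
  hyperplane that misses the origin; its normal, scaled so that the hyperplane has level one, lies
  in the polar.\<close>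

lemma bipolar:
  assumes "convex K" "closed K" "0 \<in> K"
  shows "polar (polar K) = K"
proof
  show "K \<subseteq> polar (polar K)"
    by (auto simp: polar_def inner_commute)
  show "polar (polar K) \<subseteq> K"
  proof (rule subsetI, rule ccontr)
    fix z assume z: "z \<in> polar (polar K)" "z \<notin> K"
    obtain a b where ab: "a \<bullet> z < b" "\<forall>x\<in>K. b < a \<bullet> x"
      using separating_hyperplane_closed_point[OF assms(1,2) z(2)] by blast
    have b: "b < 0" using ab(2) assms(3) by force
    have "(1 / b) *\<^sub>R a \<in> polar K"
      using ab(2) b by (force simp: polar_def divide_simps)
    then have "z \<bullet> ((1 / b) *\<^sub>R a) \<le> 1"
      using z(1) unfolding polar_def by blast
    with ab(1) b show False
      by (simp add: inner_commute divide_simps)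
  qed
qed

lemma convex_closed_msum:
  assumes "convex K" "convex L"
  shows "convex (K \<oplus>\<^sub>M L)"
proof -
  have "{x + y | x y. x \<in> K \<and> y \<in> L} = (\<Union>x\<in>K. \<Union>y\<in>L. {x + y})"
    by blast
  then show ?thesis
    unfolding closed_msum_def using convex_sums[OF assms] by (simp add: convex_closure)
qed

lemma closed_msum_commute: "K \<oplus>\<^sub>M L = L \<oplus>\<^sub>M K"
proof -
  have "{x + y | x y. x \<in> K \<and> y \<in> L} = {x + y | x y. x \<in> L \<and> y \<in> K}"
    by (auto; metis add.commute)
  then show ?thesis by (simp add: closed_msum_def)
qed

lemma zero_in_closed_msum: "0 \<in> K \<Longrightarrow> 0 \<in> L \<Longrightarrow> 0 \<in> K \<oplus>\<^sub>M L"
  unfolding closed_msum_def by (rule subsetD[OF closure_subset]) force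

section \<open>The step of the continued fraction\<close>

definition cf_step :: "'a::euclidean_space set \<Rightarrow> 'a set \<Rightarrow> 'a set" where
  "cf_step K L = polar (K \<oplus>\<^sub>M L)"

text \<open>A set and its closure have the same polar, since half-spaces are closed. Hence the closure in
  the Minkowski sum can be ignored from here on.\<close>

lemma mem_cf_step_iff: "u \<in> cf_step K L \<longleftrightarrow> (\<forall>x\<in>K. \<forall>y\<in>L. u \<bullet> (x + y) \<le> 1)"
proof
  assume "u \<in> cf_step K L"
  moreover have "x + y \<in> K \<oplus>\<^sub>M L" if "x \<in> K" "y \<in> L" for x y
    unfolding closed_msum_def using that by (intro subsetD[OF closure_subset]) blast
  ultimately show "\<forall>x\<in>K. \<forall>y\<in>L. u \<bullet> (x + y) \<le> 1"
    by (auto simp: cf_step_def polar_def)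
next
  assume *: "\<forall>x\<in>K. \<forall>y\<in>L. u \<bullet> (x + y) \<le> 1"
  have "K \<oplus>\<^sub>M L \<subseteq> {z. u \<bullet> z \<le> 1}"
    unfolding closed_msum_def using *
    by (intro closure_minimal closed_halfspace_le) auto
  then show "u \<in> cf_step K L"
    by (auto simp: cf_step_def polar_def)
qed

lemma cf_step_antimono: "L \<subseteq> M \<Longrightarrow> cf_step K M \<subseteq> cf_step K L"
  unfolding subset_iff mem_cf_step_iff by blast

lemma zero_in_cf_step: "0 \<in> cf_step K L"
  by (simp add: cf_step_def zero_in_polar)

lemma norm_mem_cf_step_le:
  assumes "cball 0 r \<subseteq> K" "cball 0 a \<subseteq> L" "r \<ge> 0" "a \<ge> 0" and u: "u \<in> cf_step K L"
  shows "(r + a) * norm u \<le> 1"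
proof (cases "u = 0")
  case False
  have "r *\<^sub>R sgn u \<in> K" "a *\<^sub>R sgn u \<in> L"
    using assms(1-4) False by (auto simp: norm_sgn intro!: subsetD[OF assms(1)] subsetD[OF assms(2)])
  then have "u \<bullet> (r *\<^sub>R sgn u + a *\<^sub>R sgn u) \<le> 1"
    using u by (simp add: mem_cf_step_iff)
  moreover have "u \<bullet> sgn u = norm u"
    using False by (simp add: sgn_div_norm flip: power2_norm_eq_inner)
      (simp add: power2_eq_square)
  ultimately show ?thesis by (simp add: inner_add_right algebra_simps)
qed simp

lemma cball_subset_cf_step:
  assumes "K \<subseteq> cball 0 R" "L \<subseteq> cball 0 b" "R > 0" "b \<ge> 0"
  shows "cball 0 (1 / (R + b)) \<subseteq> cf_step K L"
proof
  fix u :: 'a assume "u \<in> cball 0 (1 / (R + b))"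
  then have u: "norm u * (R + b) \<le> 1" using assms by (simp add: field_simps)
  show "u \<in> cf_step K L"
    unfolding mem_cf_step_iff
  proof (intro ballI)
    fix x y assume xy: "x \<in> K" "y \<in> L"
    have "u \<bullet> (x + y) \<le> norm u * norm (x + y)" by (rule norm_cauchy_schwarz)
    also have "\<dots> \<le> norm u * (R + b)"
      using assms xy norm_triangle_ineq[of x y] by (intro mult_left_mono) force+
    finally show "u \<bullet> (x + y) \<le> 1" using u by linarith
  qed
qed

text \<open>The two halves of the Hausdorff distance are kept apart because the step, which reverses
  inclusions, exchanges them.\<close>

definition close_to :: "real \<Rightarrow> 'a::euclidean_space set \<Rightarrow> 'a set \<Rightarrow> bool" where
  "close_to e A B \<longleftrightarrow> (\<forall>x\<in>A. \<exists>y\<in>B. dist x y \<le> e)"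

text \<open>Passing from \<open>L\<close> to \<open>M\<close> raises the support function of \<open>K + L\<close> at a point \<open>u\<close> of the polar
  of \<open>K + L\<close> by at most \<open>e \<parallel>u\<parallel> \<le> e / q\<close>, \<open>q = r + a\<close>. Shrinking \<open>u\<close> by the factor \<open>1 + e / q\<close>
  therefore brings it into the polar of \<open>K + M\<close>, and this moves \<open>u\<close> by at most
  \<open>\<parallel>u\<parallel> e / q \<le> e / q\<^sup>2\<close>.\<close>

lemma cf_step_contracts:
  assumes "cball 0 r \<subseteq> K" "cball 0 a \<subseteq> L" "r > 0" "a \<ge> 0" "e \<ge> 0" and near: "close_to e M L"
  shows "close_to (e / (r + a)\<^sup>2) (cf_step K L) (cf_step K M)"
  unfolding close_to_def
proof
  fix u assume u: "u \<in> cf_step K L"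
  define q where "q = r + a"
  have q: "q > 0" using assms by (simp add: q_def)
  have nu: "norm u \<le> 1 / q"
    using norm_mem_cf_step_le[OF assms(1,2) _ _ u] assms(3,4) q
    by (simp add: q_def field_simps)
  define t where "t = 1 + e / q"
  have t: "t \<ge> 1" using q assms by (simp add: t_def)
  have bound: "u \<bullet> (x + m) \<le> t" if x: "x \<in> K" and m: "m \<in> M" for x m
  proof -
    obtain l where l: "l \<in> L" "dist m l \<le> e"
      using near m by (auto simp: close_to_def)
    have "u \<bullet> (x + m) = u \<bullet> (x + l) + u \<bullet> (m - l)"
      by (simp add: algebra_simps)
    also have "u \<bullet> (x + l) \<le> 1" using u x l by (simp add: mem_cf_step_iff)
    also have "u \<bullet> (m - l) \<le> norm u * norm (m - l)" by (rule norm_cauchy_schwarz)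
    also have "\<dots> \<le> (1 / q) * e"
      using nu l q by (intro mult_mono) (auto simp: dist_norm)
    finally show ?thesis by (simp add: t_def)
  qed
  have "(1 / t) *\<^sub>R u \<in> cf_step K M"
    unfolding mem_cf_step_iff using bound t by (simp add: divide_simps)
  moreover have "dist u ((1 / t) *\<^sub>R u) \<le> e / q\<^sup>2"
  proof -
    have "dist u ((1 / t) *\<^sub>R u) = norm ((1 - 1 / t) *\<^sub>R u)"
      by (simp add: dist_norm algebra_simps)
    also have "\<dots> = (1 - 1 / t) * norm u" using t by simp
    also have "\<dots> \<le> (t - 1) * (1 / q)"
    proof (rule mult_mono[OF _ nu])
      have "(t - 1) * 1 \<le> (t - 1) * t"
        using t by (intro mult_left_mono) auto
      then show "1 - 1 / t \<le> t - 1" using t by (simp add: field_simps)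
    qed (use t in auto)
    also have "\<dots> = e / q\<^sup>2" by (simp add: t_def power2_eq_square)
    finally show ?thesis .
  qed
  ultimately show "\<exists>v\<in>cf_step K M. dist u v \<le> e / (r + a)\<^sup>2"
    unfolding q_def by blast
qed

section \<open>The iterates\<close>

text \<open>Starting from \<open>{0}\<close> puts the first approximant \<open>K\<^sup>*\<close> on the same footing as the later ones,
  and makes the base case of the interlacing trivial.\<close>

primrec cf_iterate :: "'a::euclidean_space set \<Rightarrow> nat \<Rightarrow> 'a set" where
  "cf_iterate K 0 = {0}"
| "cf_iterate K (Suc n) = cf_step K (cf_iterate K n)"

lemma approximant_replicate: "approximant (replicate (Suc n) K) = cf_iterate K (Suc n)"
proof (induction n)
  case 0
  have "polar K = cf_step K {0}"
    unfolding set_eq_iff mem_cf_step_iff by (simp add: polar_def)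
  then show ?case by simp
next
  case (Suc n)
  then show ?case by (simp add: cf_step_def)
qed

lemma zero_in_cf_iterate: "0 \<in> cf_iterate K n"
  by (cases n) (auto simp: zero_in_cf_step)

text \<open>Since the step reverses inclusions, \<open>F\<^sub>2\<^sub>k\<^sub>+\<^sub>2 \<subseteq> F\<^sub>2\<^sub>j\<^sub>+\<^sub>1\<close> follows from
  \<open>F\<^sub>2\<^sub>j \<subseteq> F\<^sub>2\<^sub>k\<^sub>+\<^sub>1\<close>. The two indices change roles while their sum decreases,
  hence the induction on the sum.\<close>

lemma even_iterate_subset_odd_iterate: "cf_iterate K (2 * k) \<subseteq> cf_iterate K (Suc (2 * j))"
proof (induction "k + j" arbitrary: k j)
  case 0
  then show ?case by (simp add: zero_in_cf_step)
next
  case (Suc n)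
  show ?case
  proof (cases k)
    case 0
    then show ?thesis by (simp add: zero_in_cf_step)
  next
    case (Suc k')
    then have "cf_iterate K (2 * j) \<subseteq> cf_iterate K (Suc (2 * k'))"
      using Suc.hyps(2) by (intro Suc.hyps(1)) simp
    from cf_step_antimono[OF this, of K] show ?thesis by (simp add: Suc)
  qed
qed

lemma cf_iterate_subset_cball:
  assumes "cball 0 r \<subseteq> K" "r > 0"
  shows "cf_iterate K n \<subseteq> cball 0 (1 / r)"
proof (cases n)
  case 0
  then show ?thesis using assms by simp
next
  case (Suc m)
  show ?thesis
  proof
    fix u assume "u \<in> cf_iterate K n"
    then have "(r + 0) * norm u \<le> 1"
      unfolding Suc cf_iterate.simps
      by (rule norm_mem_cf_step_le[rotated -1])
        (use assms zero_in_cf_iterate in auto)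
    then show "u \<in> cball 0 (1 / r)" using assms by (simp add: field_simps)
  qed
qed

section \<open>Growth of the inscribed balls\<close>

text \<open>The left-hand side equals \<open>(r - a R (r + a)) / (R (r + a) + 1)\<close>, and its numerator and
  denominator are estimated using \<open>a \<le> 1 - r\<close> and \<open>r + a \<le> 1\<close>. The lower bound is positive and
  does not depend on \<open>a\<close>.\<close>

lemma inradius_growth:
  fixes r R a :: real
  assumes "r > 0" "R > 0" "R * (1 - r) < r" "0 \<le> a" "a \<le> 1 - r"
  shows "1 / (R + 1 / (r + a)) - a \<ge> (r - R * (1 - r)) / (R + 1)"
proof -
  have ra: "r + a > 0" using assms by simp
  have den: "R * (r + a) + 1 > 0" using assms ra by (simp add: add_pos_pos)
  have "1 / (R + 1 / (r + a)) = (r + a) / (R * (r + a) + 1)"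
    using ra by (simp add: field_simps)
  then have "1 / (R + 1 / (r + a)) - a = (r + a - a * (R * (r + a) + 1)) / (R * (r + a) + 1)"
    using den by (simp add: diff_divide_distrib)
  also have "r + a - a * (R * (r + a) + 1) = r - R * (a * (r + a))"
    by (simp add: algebra_simps)
  finally have eq: "1 / (R + 1 / (r + a)) - a = (r - R * (a * (r + a))) / (R * (r + a) + 1)" .
  show ?thesis
    unfolding eq
  proof (rule frac_le)
    have "a * (r + a) \<le> (1 - r) * 1"
      using assms ra by (intro mult_mono) auto
    then have "R * (a * (r + a)) \<le> R * (1 - r)"
      using assms by (intro mult_left_mono) auto
    then show num: "r - R * (1 - r) \<le> r - R * (a * (r + a))" by simp
    then show "0 \<le> r - R * (a * (r + a))" using assms by linarith
    have "R * (r + a) \<le> R * 1" using assms by (intro mult_left_mono) auto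
    then show "R * (r + a) + 1 \<le> R + 1" by simp
    show "0 < R * (r + a) + 1" by (rule den)
  qed
qed

text \<open>By \<open>inradius_growth\<close> every two steps increase the inscribed radius by at least a fixed
  amount \<open>c\<close>, as long as it has not exceeded \<open>1 - r\<close>.\<close>

lemma inradius_eventually_large:
  assumes K: "cball 0 r \<subseteq> K" "K \<subseteq> cball 0 R" and r: "r > 0" "R > 0" "R * (1 - r) < r"
  shows "\<exists>a\<ge>0. r + a > 1 \<and> (\<exists>N. \<forall>n\<ge>N. cball 0 a \<subseteq> cf_iterate K n)"
proof -
  define c where "c = (r - R * (1 - r)) / (R + 1)"
  have c: "c > 0" using r by (simp add: c_def)
  have growth: "\<exists>a\<ge>0. (r + a > 1 \<or> a \<ge> real m * c) \<and> (\<exists>N. \<forall>n\<ge>N. cball 0 a \<subseteq> cf_iterate K n)" for m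
  proof (induction m)
    case 0
    show ?case by (rule exI[of _ 0]) (auto simp: zero_in_cf_iterate)
  next
    case (Suc m)
    then obtain a N where a: "a \<ge> 0" "r + a > 1 \<or> a \<ge> real m * c"
      and N: "\<And>n. n \<ge> N \<Longrightarrow> cball 0 a \<subseteq> cf_iterate K n" by blast
    show ?case
    proof (cases "r + a > 1")
      case True
      then show ?thesis using a N by blast
    next
      case False
      define g where "g = 1 / (R + 1 / (r + a))"
      have "g - a \<ge> c"
        unfolding g_def c_def using False a r by (intro inradius_growth) auto
      then have g: "g \<ge> real (Suc m) * c" "g \<ge> 0"
        using False a c by (auto simp: algebra_simps)
      have "cball 0 g \<subseteq> cf_iterate K n" if n: "n \<ge> N + 2" for n
      proof -
        obtain k where k: "n = Suc (Suc k)" "k \<ge> N"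
          using n by (auto dest!: le_Suc_ex)
        have "cf_iterate K (Suc k) \<subseteq> cball 0 (1 / (r + a))"
        proof
          fix u assume "u \<in> cf_iterate K (Suc k)"
          then have "(r + a) * norm u \<le> 1"
            using norm_mem_cf_step_le[OF K(1) N[OF k(2)]] a r by simp
          then show "u \<in> cball 0 (1 / (r + a))"
            using a r by (simp add: field_simps)
        qed
        from cball_subset_cf_step[OF K(2) this] show ?thesis
          using a r by (simp add: g_def k)
      qed
      then show ?thesis using g by blast
    qed
  qed
  obtain m :: nat where "1 < real m * c"
    using reals_Archimedean3[OF c] by blast
  moreover obtain a where a: "a \<ge> 0" "r + a > 1 \<or> a \<ge> real m * c"
    "\<exists>N. \<forall>n\<ge>N. cball 0 a \<subseteq> cf_iterate K n"
    using growth[of m] by blast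
  ultimately have "r + a > 1" using r(1) by linarith
  with a show ?thesis by blast
qed

section \<open>Convergence\<close>

lemma consecutive_iterates_close:
  assumes K: "cball 0 r \<subseteq> K" "r > 0" and "a \<ge> 0"
    and N: "\<And>n. n \<ge> N \<Longrightarrow> cball 0 a \<subseteq> cf_iterate K n"
  defines "e \<equiv> \<lambda>n. 2 / r * (1 / (r + a)\<^sup>2) ^ n"
  shows "close_to (e n) (cf_iterate K (N + n)) (cf_iterate K (Suc (N + n))) \<and>
         close_to (e n) (cf_iterate K (Suc (N + n))) (cf_iterate K (N + n))"
proof (induction n)
  case 0
  have *: "close_to (2 / r) (cf_iterate K i) (cf_iterate K j)" for i j
    unfolding close_to_def
  proof
    fix x assume "x \<in> cf_iterate K i"
    then have "x \<in> cball 0 (1 / r)" using cf_iterate_subset_cball[OF K] by blast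
    then have "norm x \<le> 1 / r" by simp
    also have "\<dots> \<le> 2 / r" using K by (simp add: divide_right_mono)
    finally have "dist x 0 \<le> 2 / r" by simp
    then show "\<exists>y\<in>cf_iterate K j. dist x y \<le> 2 / r"
      using zero_in_cf_iterate by blast
  qed
  show ?case unfolding e_def power_0 mult_1_right by (intro conjI *)
next
  case (Suc n)
  have e: "e (Suc n) = e n / (r + a)\<^sup>2" "e n \<ge> 0"
    using K assms by (auto simp: e_def)
  show ?case
    using cf_step_contracts[OF K(1) N[of "N + n"] K(2) \<open>a \<ge> 0\<close> e(2)]
      cf_step_contracts[OF K(1) N[of "Suc (N + n)"] K(2) \<open>a \<ge> 0\<close> e(2)] Suc e(1)
    by simp
qed

lemma close_to_mono: "close_to e A B \<Longrightarrow> A' \<subseteq> A \<Longrightarrow> B \<subseteq> B' \<Longrightarrow> close_to e A' B'"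
  unfolding close_to_def by blast

lemma subset_imp_close_to: "A \<subseteq> B \<Longrightarrow> e \<ge> 0 \<Longrightarrow> close_to e A B"
  unfolding close_to_def by (force intro: bexI)

lemma close_to_subset_thickening:
  assumes "close_to e A B" "e > 0"
  shows "A \<subseteq> B \<oplus>\<^sub>M dilate e unit_ball"
proof
  fix x assume "x \<in> A"
  then obtain y where y: "y \<in> B" "dist x y \<le> e" using assms by (auto simp: close_to_def)
  have "norm ((1 / e) *\<^sub>R (x - y)) \<le> 1"
    using y(2) assms by (simp add: dist_norm divide_simps)
  then have "e *\<^sub>R ((1 / e) *\<^sub>R (x - y)) \<in> dilate e unit_ball"
    unfolding dilate_def by (metis (mono_tags, lifting) mem_Collect_eq mem_cball_0)
  then have "x - y \<in> dilate e unit_ball" using assms by simp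
  moreover have "x = y + (x - y)" by simp
  ultimately show "x \<in> B \<oplus>\<^sub>M dilate e unit_ball"
    unfolding closed_msum_def using y(1) by (intro subsetD[OF closure_subset]) blast
qed

lemma hausdorff_distance_le:
  assumes "close_to e A B" "close_to e B A" "e > 0"
  shows "hausdorff_distance A B \<le> ereal e"
  unfolding hausdorff_distance_def
  by (rule Inf_lower) (use assms close_to_subset_thickening in blast)

lemma hausdorff_distance_nonneg: "0 \<le> hausdorff_distance A B"
  unfolding hausdorff_distance_def by (rule Inf_greatest) auto

text \<open>The gap between consecutive iterates bounds both the distance of an iterate to the squeezed
  set \<open>F\<close> and the distance of \<open>F\<close> to its image under the step.\<close>

lemma cf_iterates_converge:
  fixes K :: "'a::euclidean_space set"
  assumes K: "cball 0 r \<subseteq> K" "r > 0" and a: "a \<ge> 0" "r + a > 1"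
    and N: "\<And>n. n \<ge> N \<Longrightarrow> cball 0 a \<subseteq> cf_iterate K n"
  shows "\<exists>F\<in>convex_bodies0. (\<lambda>n. hausdorff_distance (cf_iterate K n) F) \<longlonglongrightarrow> 0 \<and> cf_step K F = F"
proof -
  define e where "e = (\<lambda>n. 2 / r * (1 / (r + a)\<^sup>2) ^ n)"
  have e_pos: "e n > 0" for n using K a by (simp add: e_def)
  have e_lim: "e \<longlonglongrightarrow> 0"
    unfolding e_def using a by (intro tendsto_mult_right_zero LIMSEQ_power_zero) (simp add: one_less_power)
  have gap: "close_to (e n) (cf_iterate K (N + n)) (cf_iterate K (Suc (N + n)))"
    "close_to (e n) (cf_iterate K (Suc (N + n))) (cf_iterate K (N + n))" for n
    using consecutive_iterates_close[OF K a(1), of N n] N unfolding e_def by blast+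
  define F where "F = (\<Inter>j. cf_iterate K (Suc (2 * j)))"
  have F_upper: "F \<subseteq> cf_iterate K (Suc (2 * j))" for j
    by (auto simp: F_def)
  have F_lower: "cf_iterate K (2 * j) \<subseteq> F" for j
    unfolding F_def using even_iterate_subset_odd_iterate by blast
  have "bounded F"
    using F_upper[of 0] cf_iterate_subset_cball[OF K] bounded_cball bounded_subset by blast
  moreover have "closed F"
    unfolding F_def by (auto simp: cf_step_def intro!: closed_INT closed_polar)
  moreover have "convex F"
    unfolding F_def by (auto simp: cf_step_def intro!: convex_INT convex_polar)
  moreover have "0 \<in> F" using F_lower[of 0] by simp
  ultimately have body: "F \<in> convex_bodies0"
    by (simp add: convex_bodies0_def compact_eq_bounded_closed)
  have close: "close_to (e n) (cf_iterate K (N + n)) F \<and> close_to (e n) F (cf_iterate K (N + n))" for n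
  proof (cases "even (N + n)")
    case True
    then obtain j where j: "N + n = 2 * j" by blast
    have "close_to (e n) (cf_iterate K (2 * j)) F"
      using F_lower e_pos[of n] by (intro subset_imp_close_to) auto
    moreover have "close_to (e n) F (cf_iterate K (2 * j))"
      using gap(2)[of n] F_upper[of j] subset_refl unfolding j by (rule close_to_mono)
    ultimately show ?thesis by (simp add: j)
  next
    case False
    then obtain j where j: "N + n = Suc (2 * j)" by (metis Suc_eq_plus1 oddE)
    have "cf_iterate K (Suc (N + n)) \<subseteq> F"
      using F_lower[of "Suc j"] by (simp add: j)
    with gap(1)[of n] have "close_to (e n) (cf_iterate K (N + n)) F"
      by (rule close_to_mono[OF _ subset_refl])
    moreover have "close_to (e n) F (cf_iterate K (N + n))"
      using F_upper[of j] e_pos[of n] unfolding j by (intro subset_imp_close_to) auto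
    ultimately show ?thesis ..
  qed
  have "(\<lambda>n. hausdorff_distance (cf_iterate K (n + N)) F) \<longlonglongrightarrow> 0"
  proof (rule tendsto_sandwich[OF _ _ tendsto_const])
    show "\<forall>\<^sub>F n in sequentially. 0 \<le> hausdorff_distance (cf_iterate K (n + N)) F"
      by (simp add: hausdorff_distance_nonneg)
    show "(\<lambda>n. ereal (e n)) \<longlonglongrightarrow> 0"
      using e_lim by (simp add: zero_ereal_def)
    show "\<forall>\<^sub>F n in sequentially. hausdorff_distance (cf_iterate K (n + N)) F \<le> ereal (e n)"
      using close e_pos by (auto simp: add.commute intro!: always_eventually hausdorff_distance_le)
  qed
  then have lim: "(\<lambda>n. hausdorff_distance (cf_iterate K n) F) \<longlonglongrightarrow> 0"
    by (rule LIMSEQ_offset)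
  have "cf_step K F = F"
  proof
    have "cf_step K F \<subseteq> cf_iterate K (Suc (2 * j))" for j
      using cf_step_antimono[OF F_lower[of j], of K] by simp
    then show "cf_step K F \<subseteq> F" by (auto simp: F_def)
    show "F \<subseteq> cf_step K F"
    proof
      fix x assume x: "x \<in> F"
      have "\<exists>y\<in>cf_step K F. dist y x < d" if d: "d > 0" for d
      proof -
        obtain M where M: "\<And>n. n \<ge> M \<Longrightarrow> e n < d"
          using order_tendstoD(2)[OF e_lim d] by (auto simp: eventually_sequentially)
        \<comment> \<open>An offset past \<open>M\<close> at which the iterate has even positive index, so that it is
          contained in the image of \<open>F\<close>.\<close>
        define n where "n = N + 2 * M + 2"
        have even: "N + n = Suc (Suc (2 * (N + M)))" by (simp add: n_def)
        obtain y where y: "y \<in> cf_iterate K (N + n)" "dist x y \<le> e n"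
          using close[of n] x by (auto simp: close_to_def)
        have "y \<in> cf_step K F"
          using y(1) cf_step_antimono[OF F_upper[of "N + M"], of K] unfolding even by auto
        moreover have "e n < d" by (rule M) (simp add: n_def)
        ultimately show ?thesis using y(2) by (auto simp: dist_commute intro!: bexI[of _ y])
      qed
      then have "x \<in> closure (cf_step K F)" by (simp add: closure_approachable)
      then show "x \<in> cf_step K F" by (simp add: cf_step_def closed_polar closure_closed)
    qed
  qed
  with body lim show ?thesis by blast
qed

lemma dilate_unit_ball:
  assumes "r > 0"
  shows "dilate r unit_ball = (cball 0 r :: 'a::euclidean_space set)"
proof -
  have "dilate r unit_ball = (\<lambda>x. r *\<^sub>R x) ` cball (0 :: 'a) 1"
    by (auto simp: dilate_def)
  then show ?thesis using cball_scale[of r "0 :: 'a" 1] assms by simp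
qed

theorem theorem4p1:
  fixes K :: "'a::euclidean_space set" and r :: real
  assumes "K \<in> closed_convex_sets0"
    and "dilate r unit_ball \<subseteq> K"
    and "r > 1 \<or> (r = 1 \<and> compact K) \<or> (0 < r \<and> r < 1 \<and> set_norm K < ereal (r / (1 - r)))"
  shows "\<exists>F \<in> convex_bodies0.
           ((\<lambda>n. hausdorff_distance (approximant (replicate (Suc n) K)) F) \<longlonglongrightarrow> 0) \<and>
           polar F = F \<oplus>\<^sub>M K"
proof -
  have r: "r > 0" using assms(3) by auto
  have K: "cball 0 r \<subseteq> K" using assms(2) r by (simp add: dilate_unit_ball)
  have K0: "convex K" "0 \<in> K" using assms(1) by (auto simp: closed_convex_sets0_def)
  have "\<exists>a\<ge>0. r + a > 1 \<and> (\<exists>N. \<forall>n\<ge>N. cball 0 a \<subseteq> cf_iterate K n)"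
  proof (cases "r > 1")
    case True
    then show ?thesis by (intro exI[of _ 0]) (auto simp: zero_in_cf_iterate)
  next
    case False
    have "\<exists>R>0. K \<subseteq> cball 0 R \<and> R * (1 - r) < r"
      using assms(3)
    proof (elim disjE conjE)
      assume "r = 1" "compact K"
      then obtain R where "R > 0" "\<forall>x\<in>K. norm x \<le> R"
        using compact_imp_bounded bounded_pos by blast
      then show ?thesis using \<open>r = 1\<close> by (intro exI[of _ R]) auto
    next
      assume r1: "r < 1" and small: "set_norm K < ereal (r / (1 - r))"
      obtain R where R: "set_norm K < ereal R" "ereal R < ereal (r / (1 - r))"
        using ereal_dense2[OF small] by blast
      have le: "ereal (norm x) < ereal R" if "x \<in> K" for x
        using SUP_upper[OF that, of "\<lambda>x. ereal (norm x)"] R(1)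
        unfolding set_norm_def by (rule le_less_trans)
      have "R > 0" using le[OF K0(2)] by simp
      moreover have "K \<subseteq> cball 0 R" using le by force
      moreover have "R * (1 - r) < r" using R(2) r1 by (simp add: field_simps)
      ultimately show ?thesis by blast
    qed (use False in simp)
    then show ?thesis using inradius_eventually_large[OF K] r by blast
  qed
  then obtain a N where a: "a \<ge> 0" "r + a > 1" "\<And>n. n \<ge> N \<Longrightarrow> cball 0 a \<subseteq> cf_iterate K n"
    by blast
  obtain F where F: "F \<in> convex_bodies0" "cf_step K F = F"
    and lim: "(\<lambda>n. hausdorff_distance (cf_iterate K n) F) \<longlonglongrightarrow> 0"
    using cf_iterates_converge[OF K r a] by blast
  have "(\<lambda>n. hausdorff_distance (approximant (replicate (Suc n) K)) F) \<longlonglongrightarrow> 0"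
    unfolding approximant_replicate using lim by (rule LIMSEQ_Suc)
  moreover have "polar F = F \<oplus>\<^sub>M K"
  proof -
    have "polar F = polar (polar (K \<oplus>\<^sub>M F))" using F(2) by (simp add: cf_step_def)
    also have "\<dots> = K \<oplus>\<^sub>M F"
      using F(1) K0
      by (intro bipolar convex_closed_msum zero_in_closed_msum)
        (auto simp: convex_bodies0_def closed_msum_def)
    finally show ?thesis by (simp add: closed_msum_commute)
  qed
  ultimately show ?thesis using F(1) by blast
qed

end
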